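(* Let $k\ge1$ and $n=2^k-1$, let $1\le r<n$, and let $\mathsf{X}\in\mathbb{R}^{n\times r}$ have unit-norm, linearly independent columns. With the notation of the context, define $$C=-(I^{\otimes k}\otimes\mathcal{C}_{\mathsf{X}})(I^{\otimes k}\otimes S_0)(I^{\otimes k}\otimes\mathcal{C}_{\mathsf{X}}^* )\,V^*\big(O(r)\otimes I^{\otimes n}\big)V.$$ Then, with $|\psi\rangle=|\mathrm{columns}(\mathsf{X})\rangle$, $$C\big(|0\rangle^{\otimes k}\otimes|\psi\rangle\big)=|0\rangle^{\otimes k}\otimes Q|\psi\rangle,$$ where $Q=-\mathcal{C}_{\mathsf{X}}S_0\mathcal{C}_{\mathsf{X}}^*S_r$.
   Context: Fermionic operators on $(\mathbb{C}^2)^{\otimes n}$ are $c_j=\sigma_z^{\otimes(j-1)}\otimes|0\rangle\langle1|\otimes I^{\otimes(n-j)}$, with $\sigma_z=\mathrm{diag}(1,-1)$. The vacuum is $|\emptyset\rangle=|0\cdots0\rangle$. For a unit $x\in\mathbb{R}^n$, set $\mathcal{C}(x)=\sum_ix_i(c_i+c_i^* )$. Put $\mathcal{C}_{\mathsf{X}}=\mathcal{C}(\mathsf{X}_{:1})\cdots\mathcal{C}(\mathsf{X}_{:r})$ and $|\mathrm{columns}(\mathsf{X})\rangle=\mathcal{C}_{\mathsf{X}}|\emptyset\rangle$. For $t\in\{0,\dots,n\}$, $P_t$ projects onto the span of computational basis states of Hamming weight $t$. Let $S_0=\mathbb{I}-2P_0$ and $S_r=\mathbb{I}-2P_r$. A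 control register of $k$ qubits is added. For $s=\sum_{\ell=0}^{k-1}s_\ell2^\ell$, set $|\mathrm{bin}(s)\rangle=|s_0\cdots s_{k-1}\rangle$. Let $U_s=\sum_{t=0}^ne^{2\mathrm{i}\pi ts/(n+1)}P_t$. $\mathrm{CU}_m$ ($m=1,\dots,k$) applies $U_{2^{m-1}}$ to the system register controlled on the $m$-th control qubit being $|1\rangle$. $H$ is the Hadamard gate. $\mathrm{IQFT}|\mathrm{bin}(y)\rangle=(n+1)^{-1/2}\sum_{z=0}^ne^{-2\mathrm{i}\pi yz/(n+1)}|\mathrm{bin}(z)\rangle$. Then $V=(\mathrm{IQFT}\otimes I^{\otimes n})(\prod_{m=1}^k\mathrm{CU}_m)(H^{\otimes k}\otimes I^{\otimes n})$. Finally $O(r)=(\sigma_x^{1-r_0}\otimes\cdots\otimes\sigma_x^{1-r_{k-1}})\mathrm{CZ}_k(\sigma_x^{1-r_0}\otimes\cdots\otimes\sigma_x^{1-r_{k-1}})$, where $r=\sum_\ell r_\ell2^\ell$ and $\mathrm{CZ}_k$ negates $|1\rangle^{\otimes k}$ and fixes all other basis states. *)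

theory Defs
  imports "Jordan_Normal_Form.Schur_Decomposition"
begin

text \<open>Conventions. An N-qubit register is modelled by complex vectors/matrices of
dimension 2^N. The basis state |b_1 ... b_N> (qubit 1 leftmost) is the unit vector with
index sum_j b_j 2^(N-j), so the tensor product is the Kronecker product below
(left factor = most significant). Adjoint is mat_adjoint.\<close>

definition kron :: "complex mat \<Rightarrow> complex mat \<Rightarrow> complex mat" where
  "kron A B = mat (dim_row A * dim_row B) (dim_col A * dim_col B)
     (\<lambda>(i, j). A $$ (i div dim_row B, j div dim_col B) * B $$ (i mod dim_row B, j mod dim_col B))"

definition vkron :: "complex vec \<Rightarrow> complex vec \<Rightarrow> complex vec" where
  "vkron v w = vec (dim_vec v * dim_vec w) (\<lambda>i. v $ (i div dim_vec w) * w $ (i mod dim_vec w))"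

definition kron_list :: "complex mat list \<Rightarrow> complex mat" where
  "kron_list Ms = foldr kron Ms (1\<^sub>m 1)"

definition sum_mats :: "nat \<Rightarrow> complex mat list \<Rightarrow> complex mat" where
  "sum_mats d Ms = foldr (+) Ms (0\<^sub>m d d)"

definition prod_mats :: "nat \<Rightarrow> complex mat list \<Rightarrow> complex mat" where
  "prod_mats d Ms = foldr (*) Ms (1\<^sub>m d)"

definition sigma_z :: "complex mat" where
  "sigma_z = mat 2 2 (\<lambda>(i, j). if i = j then (if i = 0 then 1 else -1) else 0)"
definition sigma_x :: "complex mat" where
  "sigma_x = mat 2 2 (\<lambda>(i, j). if i \<noteq> j then 1 else 0)"
definition ket0bra1 :: "complex mat" where
  "ket0bra1 = mat 2 2 (\<lambda>(i, j). if i = 0 \<and> j = 1 then 1 else 0)"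
definition ket0bra0 :: "complex mat" where
  "ket0bra0 = mat 2 2 (\<lambda>(i, j). if i = 0 \<and> j = 0 then 1 else 0)"
definition ket1bra1 :: "complex mat" where
  "ket1bra1 = mat 2 2 (\<lambda>(i, j). if i = 1 \<and> j = 1 then 1 else 0)"
definition hadamard :: "complex mat" where
  "hadamard = mat 2 2 (\<lambda>(i, j). (if i = 1 \<and> j = 1 then -1 else 1) / complex_of_real (sqrt 2))"

text \<open>Fermionic annihilation operator c_j on n qubits (1 \<le> j \<le> n).\<close>
definition fermi_c :: "nat \<Rightarrow> nat \<Rightarrow> complex mat" where
  "fermi_c n j = kron_list (replicate (j - 1) sigma_z @ [ket0bra1] @ replicate (n - j) (1\<^sub>m 2))"

definition majorana :: "nat \<Rightarrow> (nat \<Rightarrow> real) \<Rightarrow> complex mat" where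
  "majorana n x = sum_mats (2 ^ n)
     (map (\<lambda>i. complex_of_real (x i) \<cdot>\<^sub>m (fermi_c n i + mat_adjoint (fermi_c n i))) [1..<n + 1])"

text \<open>C_X = C(X_{:1}) ... C(X_{:r}) for a real n x r matrix X (0-based JNF indices).\<close>
definition C_X :: "nat \<Rightarrow> real mat \<Rightarrow> complex mat" where
  "C_X n X = prod_mats (2 ^ n) (map (\<lambda>l. majorana n (\<lambda>i. X $$ (i - 1, l))) [0..<dim_col X])"

definition columns_state :: "nat \<Rightarrow> real mat \<Rightarrow> complex vec" where
  "columns_state n X = C_X n X *\<^sub>v unit_vec (2 ^ n) 0"

definition hweight :: "nat \<Rightarrow> nat \<Rightarrow> nat" where
  "hweight n a = card {l. l < n \<and> odd (a div 2 ^ l)}"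

definition proj_P :: "nat \<Rightarrow> nat \<Rightarrow> complex mat" where
  "proj_P n t = mat (2 ^ n) (2 ^ n) (\<lambda>(a, b). if a = b \<and> hweight n a = t then 1 else 0)"

definition refl_S :: "nat \<Rightarrow> nat \<Rightarrow> complex mat" where
  "refl_S n t = 1\<^sub>m (2 ^ n) - 2 \<cdot>\<^sub>m proj_P n t"

definition U_op :: "nat \<Rightarrow> nat \<Rightarrow> complex mat" where
  "U_op n s = sum_mats (2 ^ n) (map (\<lambda>t.
      exp (2 * \<i> * complex_of_real pi * of_nat t * of_nat s / of_nat (n + 1)) \<cdot>\<^sub>m proj_P n t) [0..<n + 1])"

definition CU :: "nat \<Rightarrow> nat \<Rightarrow> nat \<Rightarrow> complex mat" where
  "CU k n m =
     kron (kron_list (replicate (m - 1) (1\<^sub>m 2) @ [ket0bra0] @ replicate (k - m) (1\<^sub>m 2))) (1\<^sub>m (2 ^ n))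
   + kron (kron_list (replicate (m - 1) (1\<^sub>m 2) @ [ket1bra1] @ replicate (k - m) (1\<^sub>m 2))) (U_op n (2 ^ (m - 1)))"

text \<open>The integer s encoded by the k-qubit basis index a, where |bin(s)> = |s_0 ... s_{k-1}>
  (s_0 on the first, i.e. leftmost, qubit).\<close>
definition bin_val :: "nat \<Rightarrow> nat \<Rightarrow> nat" where
  "bin_val k a = (\<Sum>l<k. (a div 2 ^ (k - 1 - l) mod 2) * 2 ^ l)"

definition IQFT :: "nat \<Rightarrow> nat \<Rightarrow> complex mat" where
  "IQFT k n = mat (2 ^ k) (2 ^ k) (\<lambda>(a, b).
      exp (- 2 * \<i> * complex_of_real pi * of_nat (bin_val k b) * of_nat (bin_val k a) / of_nat (n + 1))
      / complex_of_real (sqrt (real (n + 1))))"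

definition V_op :: "nat \<Rightarrow> nat \<Rightarrow> complex mat" where
  "V_op k n = kron (IQFT k n) (1\<^sub>m (2 ^ n))
     * prod_mats (2 ^ (k + n)) (map (CU k n) [1..<k + 1])
     * kron (kron_list (replicate k hadamard)) (1\<^sub>m (2 ^ n))"

definition CZ :: "nat \<Rightarrow> complex mat" where
  "CZ k = mat (2 ^ k) (2 ^ k) (\<lambda>(a, b). if a = b then (if a = 2 ^ k - 1 then -1 else 1) else 0)"

definition O_op :: "nat \<Rightarrow> nat \<Rightarrow> complex mat" where
  "O_op k r = (let Xr = kron_list (map (\<lambda>l. if r div 2 ^ l mod 2 = 1 then 1\<^sub>m 2 else sigma_x) [0..<k])
               in Xr * CZ k * Xr)"

end

theory Submission
  imports Defs
begin

text \<open>Phase estimation of the Hamming weight is exact, because the control register has exactly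
\<open>2\<^sup>k = n + 1\<close> basis states, one for each weight \<open>0, \<dots>, n\<close>: for every system vector \<open>v\<close>, the circuit \<open>V\<close> sends
\<open>|0\<rangle> \<otimes> v\<close> to \<open>\<Sum>\<^sub>b v\<^sub>b |bin(|b|)\<rangle>|b\<rangle>\<close>. On such a tagged state \<open>O(r)\<close> on the control register acts
like \<open>S\<^sub>r\<close> on the system, and since \<open>V\<close> is an isometry, \<open>V\<^sup>*\<close> returns the tag to \<open>|0\<rangle>\<close>.\<close>

section \<open>Kronecker products\<close>

lemma dim_kron [simp]:
  "dim_row (kron A B) = dim_row A * dim_row B"
  "dim_col (kron A B) = dim_col A * dim_col B"
  by (simp_all add: kron_def)

lemma index_kron [simp]:
  "i < dim_row A * dim_row B \<Longrightarrow> j < dim_col A * dim_col B \<Longrightarrow>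
   kron A B $$ (i, j) = A $$ (i div dim_row B, j div dim_col B) * B $$ (i mod dim_row B, j mod dim_col B)"
  by (simp add: kron_def)

lemma dim_vkron [simp]: "dim_vec (vkron v w) = dim_vec v * dim_vec w"
  by (simp add: vkron_def)

lemma index_vkron [simp]:
  "i < dim_vec v * dim_vec w \<Longrightarrow> vkron v w $ i = v $ (i div dim_vec w) * w $ (i mod dim_vec w)"
  by (simp add: vkron_def)

lemma div_mod_less_mult:
  fixes i m n :: nat
  assumes "i < m * n"
  shows "i div n < m" "i mod n < n"
  using assms by (auto simp: less_mult_imp_div_less intro!: mod_less_divisor gr0I)

text \<open>Joint indices of a Kronecker product encode pairs \<open>(a, b)\<close> as
  \<open>a * n + b\<close>. This change of variables turns a scalar product over the joint index
  into a double sum, which \<open>sum_product\<close> can then factor.\<close>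

lemma sum_div_mod:
  fixes f :: "nat \<Rightarrow> nat \<Rightarrow> 'a :: comm_monoid_add"
  shows "(\<Sum>i<m * n. f (i div n) (i mod n)) = (\<Sum>a<m. \<Sum>b<n. f a b)"
proof -
  have "(\<Sum>a<m. \<Sum>b<n. f a b) = (\<Sum>(a, b)\<in>{..<m} \<times> {..<n}. f a b)"
    by (rule sum.cartesian_product)
  also have "\<dots> = (\<Sum>i<m * n. f (i div n) (i mod n))"
  proof (rule sum.reindex_bij_witness[where i = "\<lambda>i. (i div n, i mod n)" and j = "\<lambda>(a, b). a * n + b"])
    fix x assume "x \<in> {..<m} \<times> {..<n}"
    then obtain a b where x: "x = (a, b)" "a < m" "b < n" by auto
    have "a * n + b < (a + 1) * n" using x by simp
    also have "\<dots> \<le> m * n" using x by (intro mult_right_mono) auto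
    finally show "(case x of (a, b) \<Rightarrow> a * n + b) \<in> {..<m * n}" using x by simp
  qed (auto simp: div_mod_less_mult)
  finally show ?thesis by simp
qed

lemma kron_mult:
  assumes "dim_col A = dim_row C" "dim_col B = dim_row D"
  shows "kron A B * kron C D = kron (A * C) (B * D)"
proof (rule eq_matI)
  fix i j assume "i < dim_row (kron (A * C) (B * D))" "j < dim_col (kron (A * C) (B * D))"
  then have i: "i < dim_row A * dim_row B" and j: "j < dim_col C * dim_col D" by simp_all
  let ?f = "\<lambda>a b. A $$ (i div dim_row B, a) * C $$ (a, j div dim_col D) *
      (B $$ (i mod dim_row B, b) * D $$ (b, j mod dim_col D))"
  have "(kron A B * kron C D) $$ (i, j) =
      (\<Sum>x<dim_row C * dim_row D. ?f (x div dim_row D) (x mod dim_row D))"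
    using i j assms
    by (simp add: scalar_prod_def atLeast0LessThan div_mod_less_mult mult_ac)
  also have "\<dots> = (\<Sum>a<dim_row C. \<Sum>b<dim_row D. ?f a b)" by (rule sum_div_mod)
  also have "\<dots> = kron (A * C) (B * D) $$ (i, j)"
    using i j assms
    by (simp add: scalar_prod_def atLeast0LessThan div_mod_less_mult sum_product)
  finally show "(kron A B * kron C D) $$ (i, j) = kron (A * C) (B * D) $$ (i, j)" .
qed simp_all

lemma kron_mult_vkron:
  assumes "dim_col A = dim_vec v" "dim_col B = dim_vec w"
  shows "kron A B *\<^sub>v vkron v w = vkron (A *\<^sub>v v) (B *\<^sub>v w)"
proof (rule eq_vecI)
  fix i assume "i < dim_vec (vkron (A *\<^sub>v v) (B *\<^sub>v w))"
  then have i: "i < dim_row A * dim_row B" by simp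
  let ?f = "\<lambda>a b. A $$ (i div dim_row B, a) * v $ a * (B $$ (i mod dim_row B, b) * w $ b)"
  have "(kron A B *\<^sub>v vkron v w) $ i = (\<Sum>x<dim_vec v * dim_vec w. ?f (x div dim_vec w) (x mod dim_vec w))"
    using i assms
    by (simp add: scalar_prod_def atLeast0LessThan div_mod_less_mult mult_ac)
  also have "\<dots> = (\<Sum>a<dim_vec v. \<Sum>b<dim_vec w. ?f a b)" by (rule sum_div_mod)
  also have "\<dots> = vkron (A *\<^sub>v v) (B *\<^sub>v w) $ i"
    using i assms
    by (simp add: scalar_prod_def atLeast0LessThan div_mod_less_mult sum_product)
  finally show "(kron A B *\<^sub>v vkron v w) $ i = vkron (A *\<^sub>v v) (B *\<^sub>v w) $ i" .
qed simp_all

lemma kron_one: "kron (1\<^sub>m m) (1\<^sub>m n) = 1\<^sub>m (m * n)"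
proof (rule eq_matI)
  fix i j assume "i < dim_row (1\<^sub>m (m * n) :: complex mat)" "j < dim_col (1\<^sub>m (m * n) :: complex mat)"
  moreover have "i = j" if "i div n = j div n" "i mod n = j mod n"
    using that by (metis div_mult_mod_eq)
  ultimately show "kron (1\<^sub>m m) (1\<^sub>m n) $$ (i, j) = 1\<^sub>m (m * n) $$ (i, j)"
    by (auto simp: div_mod_less_mult)
qed simp_all

text \<open>In contrast to \<open>kron_mult_vkron\<close>, the vector may be entangled, as it is
  once the controlled phases have acted. The identity factor removes every term whose system index
  differs from \<open>i mod n\<close>.\<close>

lemma kron_one_mult_vec_index:
  assumes "i < dim_row A * n" "dim_vec v = dim_col A * n"
  shows "(kron A (1\<^sub>m n) *\<^sub>v v) $ i = (\<Sum>a<dim_col A. A $$ (i div n, a) * v $ (a * n + i mod n))"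
proof -
  have n: "i mod n < n" "i div n < dim_row A" using assms by (auto simp: div_mod_less_mult)
  have "(kron A (1\<^sub>m n) *\<^sub>v v) $ i = (\<Sum>x<dim_col A * n. A $$ (i div n, x div n) *
      (if x mod n = i mod n then 1 else 0) * v $ (x div n * n + x mod n))"
    using assms n
    by (simp add: scalar_prod_def atLeast0LessThan) (intro sum.cong, auto simp: div_mod_less_mult)
  also have "\<dots> = (\<Sum>a<dim_col A. \<Sum>b<n. A $$ (i div n, a) * (if b = i mod n then 1 else 0) * v $ (a * n + b))"
    by (rule sum_div_mod)
  also have "\<dots> = (\<Sum>a<dim_col A. A $$ (i div n, a) * v $ (a * n + i mod n))"
    using n by (intro sum.cong refl) (simp add: if_distrib if_distribR cong: if_cong)
  finally show ?thesis .
qed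

section \<open>Adjoints and isometries\<close>

lemma dim_mat_adjoint [simp]:
  "dim_row (mat_adjoint A) = dim_col A" "dim_col (mat_adjoint A) = dim_row A"
  by (simp_all add: mat_adjoint_def)

lemma index_mat_adjoint [simp]:
  fixes A :: "complex mat"
  shows "i < dim_col A \<Longrightarrow> j < dim_row A \<Longrightarrow> mat_adjoint A $$ (i, j) = cnj (A $$ (j, i))"
  by (simp add: mat_adjoint_def mat_of_rows_index conjugate_vec_def)

lemma mat_adjoint_mult:
  fixes A B :: "complex mat"
  assumes "dim_col A = dim_row B"
  shows "mat_adjoint (A * B) = mat_adjoint B * mat_adjoint A"
  using assms by (intro eq_matI) (auto simp: scalar_prod_def mult.commute intro!: sum.cong)

lemma mat_adjoint_kron: "mat_adjoint (kron A B) = kron (mat_adjoint A) (mat_adjoint B)"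
  by (intro eq_matI) (auto simp: div_mod_less_mult)

text \<open>This is the side of unitarity by which the adjoint of the circuit \<open>V\<close>
  undoes \<open>V\<close>.\<close>

definition isometric_mat :: "complex mat \<Rightarrow> bool" where
  "isometric_mat A \<longleftrightarrow> mat_adjoint A * A = 1\<^sub>m (dim_col A)"

lemma isometric_mat_mult:
  assumes "isometric_mat A" "isometric_mat B" "dim_col A = dim_row B"
  shows "isometric_mat (A * B)"
proof -
  have A: "A \<in> carrier_mat (dim_row A) (dim_row B)" using assms by auto
  have B: "B \<in> carrier_mat (dim_row B) (dim_col B)" by auto
  have A': "mat_adjoint A \<in> carrier_mat (dim_row B) (dim_row A)" using assms by auto
  have B': "mat_adjoint B \<in> carrier_mat (dim_col B) (dim_row B)" by auto
  have "mat_adjoint (A * B) * (A * B) = mat_adjoint B * (mat_adjoint A * (A * B))"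
    unfolding mat_adjoint_mult[OF assms(3)] by (rule assoc_mult_mat[OF B' A' mult_carrier_mat[OF A B]])
  also have "mat_adjoint A * (A * B) = B"
    using assms(1,3) assoc_mult_mat[OF A' A B] by (metis B isometric_mat_def left_mult_one_mat)
  finally show ?thesis using assms(2) by (simp add: isometric_mat_def)
qed

lemma isometric_mat_kron:
  "isometric_mat A \<Longrightarrow> isometric_mat B \<Longrightarrow> isometric_mat (kron A B)"
  by (simp add: isometric_mat_def mat_adjoint_kron kron_mult kron_one)

lemma isometric_mat_one: "isometric_mat (1\<^sub>m n)"
proof -
  have "mat_adjoint (1\<^sub>m n :: complex mat) = 1\<^sub>m n" by (intro eq_matI) auto
  then show ?thesis by (simp add: isometric_mat_def)
qed

lemma isometric_mat_kron_list:
  "(\<And>M. M \<in> set Ms \<Longrightarrow> isometric_mat M) \<Longrightarrow> isometric_mat (kron_list Ms)"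
  by (induction Ms) (auto simp: kron_list_def isometric_mat_one intro!: isometric_mat_kron)

section \<open>Diagonal matrices\<close>

text \<open>The controlled phases, the reflections and the marking operator are all diagonal in the
  computational basis; with the diagonal given as a function, their algebra becomes pointwise
  arithmetic.\<close>

definition diag_of :: "nat \<Rightarrow> (nat \<Rightarrow> complex) \<Rightarrow> complex mat" where
  "diag_of d f = mat d d (\<lambda>(i, j). if i = j then f i else 0)"

lemma dim_diag_of [simp]: "dim_row (diag_of d f) = d" "dim_col (diag_of d f) = d"
  by (simp_all add: diag_of_def)

lemma index_diag_of [simp]:
  "i < d \<Longrightarrow> j < d \<Longrightarrow> diag_of d f $$ (i, j) = (if i = j then f i else 0)"
  by (simp add: diag_of_def)

lemma diag_of_cong: "(\<And>i. i < d \<Longrightarrow> f i = g i) \<Longrightarrow> diag_of d f = diag_of d g"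
  by (intro eq_matI) auto

lemma one_mat_eq_diag_of: "1\<^sub>m d = diag_of d (\<lambda>_. 1)"
  by (intro eq_matI) auto

lemma diag_of_mult_vec_index:
  assumes "i < d" "dim_vec v = d"
  shows "(diag_of d f *\<^sub>v v) $ i = f i * v $ i"
proof -
  have "(diag_of d f *\<^sub>v v) $ i = (\<Sum>x<d. (if i = x then f i else 0) * v $ x)"
    using assms by (simp add: scalar_prod_def atLeast0LessThan)
  also have "\<dots> = (\<Sum>x<d. if i = x then f x * v $ x else 0)" by (intro sum.cong) auto
  finally have "(diag_of d f *\<^sub>v v) $ i = (\<Sum>x<d. if i = x then f x * v $ x else 0)" .
  then show ?thesis using assms by simp
qed

lemma diag_of_mult: "diag_of d f * diag_of d g = diag_of d (\<lambda>i. f i * g i)"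
proof (rule eq_matI)
  fix i j assume "i < dim_row (diag_of d (\<lambda>i. f i * g i))" "j < dim_col (diag_of d (\<lambda>i. f i * g i))"
  then show "(diag_of d f * diag_of d g) $$ (i, j) = diag_of d (\<lambda>i. f i * g i) $$ (i, j)"
    using diag_of_mult_vec_index[of i d "col (diag_of d g) j" f] by simp
qed simp_all

lemma diag_of_kron:
  "kron (diag_of m f) (diag_of n g) = diag_of (m * n) (\<lambda>i. f (i div n) * g (i mod n))"
proof (rule eq_matI)
  fix i j assume "i < dim_row (diag_of (m * n) (\<lambda>i. f (i div n) * g (i mod n)))"
    "j < dim_col (diag_of (m * n) (\<lambda>i. f (i div n) * g (i mod n)))"
  moreover have "i = j" if "i div n = j div n" "i mod n = j mod n"
    using that by (metis div_mult_mod_eq)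
  ultimately show "kron (diag_of m f) (diag_of n g) $$ (i, j) =
      diag_of (m * n) (\<lambda>i. f (i div n) * g (i mod n)) $$ (i, j)"
    by (auto simp: div_mod_less_mult)
qed simp_all

lemma isometric_diag_of:
  assumes "\<And>i. i < d \<Longrightarrow> cmod (f i) = 1"
  shows "isometric_mat (diag_of d f)"
proof -
  have "mat_adjoint (diag_of d f) = diag_of d (\<lambda>i. cnj (f i))" by (intro eq_matI) auto
  moreover have "cnj (f i) * f i = 1" if "i < d" for i
    using assms[OF that] complex_norm_square[of "f i"] by (simp add: mult.commute)
  ultimately show ?thesis
    by (auto simp: isometric_mat_def diag_of_mult one_mat_eq_diag_of intro: diag_of_cong)
qed

lemma sum_mats_diag_of:
  "sum_mats d (map (\<lambda>t. diag_of d (f t)) ts) = diag_of d (\<lambda>i. \<Sum>t\<leftarrow>ts. f t i)"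
proof (induction ts)
  case Nil
  show ?case by (auto simp: sum_mats_def intro!: eq_matI)
next
  case (Cons t ts)
  then have "sum_mats d (map (\<lambda>t. diag_of d (f t)) (t # ts)) =
      diag_of d (f t) + diag_of d (\<lambda>i. \<Sum>t\<leftarrow>ts. f t i)"
    by (simp add: sum_mats_def)
  also have "\<dots> = diag_of d (\<lambda>i. \<Sum>t\<leftarrow>t # ts. f t i)" by (intro eq_matI) auto
  finally show ?case .
qed

lemma prod_mats_diag_of:
  "prod_mats d (map (\<lambda>t. diag_of d (f t)) ts) = diag_of d (\<lambda>i. \<Prod>t\<leftarrow>ts. f t i)"
  by (induction ts) (simp_all add: prod_mats_def diag_of_mult one_mat_eq_diag_of)

section \<open>Kronecker products of one-qubit gates, read off from the bits of the indices\<close>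

text \<open>Serves the inductions on the number of qubits or bits: removing the leading bit replaces
  an index by its remainder, and the lower bits must survive this.\<close>

lemma mod_pow2_div_pow2_mod_2:
  assumes "j < n"
  shows "(a::nat) mod 2 ^ n div 2 ^ j mod 2 = a div 2 ^ j mod 2"
proof -
  have "a mod 2 ^ n div 2 ^ j = a div 2 ^ j mod 2 ^ (n - j)"
    using div_exp_mod_exp_eq[of a j "n - j"] assms by simp
  then show ?thesis using assms by (simp add: mod_mod_cancel)
qed

lemma carrier_kron_list:
  assumes "\<And>M. M \<in> set Ms \<Longrightarrow> M \<in> carrier_mat 2 2"
  shows "kron_list Ms \<in> carrier_mat (2 ^ length Ms) (2 ^ length Ms)"
  using assms
proof (induction Ms)
  case (Cons M Ms)
  then have "M \<in> carrier_mat 2 2" "kron_list Ms \<in> carrier_mat (2 ^ length Ms) (2 ^ length Ms)" by auto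
  then show ?case by (auto simp: kron_list_def)
qed (simp add: kron_list_def)

lemma kron_list_replicate_one: "kron_list (replicate q (1\<^sub>m 2)) = 1\<^sub>m (2 ^ q)"
  by (induction q) (simp_all add: kron_list_def kron_one)

text \<open>The leftmost factor is the most significant, so a gate with \<open>q\<close> qubits to
  its right reads bit \<open>q\<close> of the index. Each further identity on the left only prepends
  a bit.\<close>

lemma kron_list_single_diag_of:
  "kron_list (replicate p (1\<^sub>m 2) @ [diag_of 2 g] @ replicate q (1\<^sub>m 2)) =
   diag_of (2 ^ (p + 1 + q)) (\<lambda>i. g (i div 2 ^ q mod 2))"
proof (induction p)
  case 0
  have "kron_list ([diag_of 2 g] @ replicate q (1\<^sub>m 2)) = kron (diag_of 2 g) (diag_of (2 ^ q) (\<lambda>_. 1))"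
    using kron_list_replicate_one[of q] by (simp add: kron_list_def one_mat_eq_diag_of)
  also have "\<dots> = diag_of (2 ^ (0 + 1 + q)) (\<lambda>i. g (i div 2 ^ q mod 2))"
    unfolding diag_of_kron by (auto simp: less_mult_imp_div_less intro!: diag_of_cong)
  finally show ?case by simp
next
  case (Suc p)
  then have "kron_list (replicate (Suc p) (1\<^sub>m 2) @ [diag_of 2 g] @ replicate q (1\<^sub>m 2)) =
    kron (diag_of 2 (\<lambda>_. 1)) (diag_of (2 ^ (p + 1 + q)) (\<lambda>i. g (i div 2 ^ q mod 2)))"
    by (simp add: kron_list_def one_mat_eq_diag_of)
  also have "\<dots> = diag_of (2 * 2 ^ (p + 1 + q)) (\<lambda>i. g (i div 2 ^ q mod 2))"
    unfolding diag_of_kron by (intro diag_of_cong) (subst mod_pow2_div_pow2_mod_2, simp_all)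
  finally show ?case by simp
qed

text \<open>Splitting off the head factor splits an index into its top bit
  \<open>a div 2 ^ ?n\<close> and the remainder \<open>a mod 2 ^ ?n\<close>. Hence factor
  \<open>l\<close>, counted from the left, sees bit \<open>length Ms - 1 - l\<close>.\<close>

lemma index_kron_list:
  assumes "\<And>M. M \<in> set Ms \<Longrightarrow> M \<in> carrier_mat 2 2" "a < 2 ^ length Ms" "b < 2 ^ length Ms"
  shows "kron_list Ms $$ (a, b) = (\<Prod>l<length Ms. (Ms ! l) $$
    (a div 2 ^ (length Ms - 1 - l) mod 2, b div 2 ^ (length Ms - 1 - l) mod 2))"
  using assms
proof (induction Ms arbitrary: a b)
  case Nil
  then show ?case by (simp add: kron_list_def)
next
  case (Cons M Ms)
  let ?n = "length Ms"
  have M: "M \<in> carrier_mat 2 2" and Ms: "\<And>M. M \<in> set Ms \<Longrightarrow> M \<in> carrier_mat 2 2"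
    using Cons.prems by auto
  have d: "dim_row (kron_list Ms) = 2 ^ ?n" "dim_col (kron_list Ms) = 2 ^ ?n"
    using carrier_kron_list[OF Ms] by auto
  have ab: "a < 2 * 2 ^ ?n" "b < 2 * 2 ^ ?n" using Cons.prems by auto
  have "kron_list (M # Ms) $$ (a, b) = kron M (kron_list Ms) $$ (a, b)"
    by (simp add: kron_list_def)
  also have "\<dots> = M $$ (a div 2 ^ ?n, b div 2 ^ ?n) * kron_list Ms $$ (a mod 2 ^ ?n, b mod 2 ^ ?n)"
    using M d ab by (subst index_kron) auto
  also have "kron_list Ms $$ (a mod 2 ^ ?n, b mod 2 ^ ?n) = (\<Prod>l<?n. (Ms ! l) $$
    (a mod 2 ^ ?n div 2 ^ (?n - 1 - l) mod 2, b mod 2 ^ ?n div 2 ^ (?n - 1 - l) mod 2))"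
    using Ms by (intro Cons.IH) auto
  also have "M $$ (a div 2 ^ ?n, b div 2 ^ ?n) * \<dots> = (\<Prod>l<length (M # Ms). ((M # Ms) ! l) $$
    (a div 2 ^ (length (M # Ms) - 1 - l) mod 2, b div 2 ^ (length (M # Ms) - 1 - l) mod 2))"
    unfolding length_Cons prod.lessThan_Suc_shift using ab
    by (intro arg_cong2[of _ _ _ _ "(*)"] prod.cong)
       (auto simp: mod_pow2_div_pow2_mod_2 less_mult_imp_div_less)
  finally show ?case .
qed

section \<open>Binary expansions\<close>

lemma bit_sum_less:
  assumes "\<And>l. l < k \<Longrightarrow> f l < (2::nat)"
  shows "(\<Sum>l<k. f l * 2 ^ l) < 2 ^ k"
  using assms
proof (induction k)
  case (Suc k)
  have "(\<Sum>l<k. f l * 2 ^ l) < 2 ^ k" using Suc by auto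
  moreover have "f k * 2 ^ k \<le> 1 * 2 ^ k" using Suc.prems[of k] by (intro mult_right_mono) auto
  ultimately have "(\<Sum>l<k. f l * 2 ^ l) + f k * 2 ^ k < 2 ^ k + 1 * 2 ^ k" by (rule add_less_le_mono)
  then show ?case by simp
qed simp

lemma bit_of_bit_sum:
  assumes "\<And>l. l < k \<Longrightarrow> f l < (2::nat)" "j < k"
  shows "(\<Sum>l<k. f l * 2 ^ l) div 2 ^ j mod 2 = f j"
  using assms
proof (induction k)
  case (Suc k)
  let ?s = "\<Sum>l<k. f l * 2 ^ l"
  have s: "?s < 2 ^ k" using Suc.prems by (intro bit_sum_less) auto
  show ?case
  proof (cases "j = k")
    case True
    then show ?thesis using s Suc.prems(1)[of k] by simp
  next
    case False
    then have j: "j < k" using Suc.prems by simp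
    \<comment> \<open>The new summand \<open>f k * 2 ^ k\<close> vanishes modulo
      \<open>2 ^ k\<close>, so it cannot affect a bit below position \<open>k\<close>.\<close>
    have "(\<Sum>l<Suc k. f l * 2 ^ l) div 2 ^ j mod 2 = (?s + f k * 2 ^ k) mod 2 ^ k div 2 ^ j mod 2"
      unfolding mod_pow2_div_pow2_mod_2[OF j] by simp
    also have "\<dots> = ?s div 2 ^ j mod 2" using s by simp
    finally show ?thesis using Suc.IH Suc.prems j by simp
  qed
qed simp

lemma bit_sum_of_bits:
  assumes "a < 2 ^ k"
  shows "(\<Sum>l<k. (a div 2 ^ l mod 2) * 2 ^ l) = (a::nat)"
  using assms
proof (induction k arbitrary: a)
  case (Suc k)
  have "(\<Sum>l<k. (a div 2 ^ l mod 2) * 2 ^ l) = (\<Sum>l<k. (a mod 2 ^ k div 2 ^ l mod 2) * 2 ^ l)"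
    by (simp add: mod_pow2_div_pow2_mod_2)
  also have "\<dots> = a mod 2 ^ k" by (rule Suc.IH) simp
  finally show ?case using Suc.prems div_mult_mod_eq[of a "2 ^ k"]
    by (simp add: less_mult_imp_div_less)
qed simp

lemma bin_val_less: "bin_val k a < 2 ^ k"
  unfolding bin_val_def by (intro bit_sum_less) auto

text \<open>Uniqueness of binary digits. The position \<open>k - 1 - l\<close> reflects that
  \<open>bin_val\<close> reverses the bits of the index: the leftmost qubit is the top bit of the
  index but carries the lowest bit of the encoded integer.\<close>

lemma bin_val_eq_iff:
  assumes "s < 2 ^ k"
  shows "bin_val k a = s \<longleftrightarrow> (\<forall>l<k. a div 2 ^ (k - 1 - l) mod 2 = s div 2 ^ l mod 2)"
proof
  assume "bin_val k a = s"
  then show "\<forall>l<k. a div 2 ^ (k - 1 - l) mod 2 = s div 2 ^ l mod 2"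
    unfolding bin_val_def by (auto simp: bit_of_bit_sum)
next
  assume "\<forall>l<k. a div 2 ^ (k - 1 - l) mod 2 = s div 2 ^ l mod 2"
  then have "bin_val k a = (\<Sum>l<k. (s div 2 ^ l mod 2) * 2 ^ l)"
    unfolding bin_val_def by (intro sum.cong) auto
  then show "bin_val k a = s" using bit_sum_of_bits[OF assms] by simp
qed

text \<open>Bit reversal is injective by uniqueness of digits, and an injective self-map of a finite
  set is onto. This permits summing over encoded integers instead of basis indices.\<close>

lemma bij_betw_bin_val: "bij_betw (bin_val k) {..<2 ^ k} {..<2 ^ k}"
proof -
  have "inj_on (bin_val k) {..<2 ^ k}"
  proof (rule inj_onI)
    fix a b :: nat assume ab: "a \<in> {..<2 ^ k}" "b \<in> {..<2 ^ k}" "bin_val k a = bin_val k b"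
    have "a div 2 ^ l mod 2 = b div 2 ^ l mod 2" if "l < k" for l
    proof -
      \<comment> \<open>Using the digit criterion at the mirrored position \<open>k - 1 - l\<close>
        compares bit \<open>l\<close> of \<open>a\<close> with bit \<open>l\<close> of
        \<open>b\<close>, through the common value \<open>bin_val k b\<close>.\<close>
      have "k - 1 - (k - 1 - l) = l" "k - 1 - l < k" using that by auto
      then show ?thesis
        using bin_val_eq_iff[OF bin_val_less, of k a b] bin_val_eq_iff[OF bin_val_less, of k b b] ab(3)
        by metis
    qed
    then have "(\<Sum>l<k. (a div 2 ^ l mod 2) * 2 ^ l) = (\<Sum>l<k. (b div 2 ^ l mod 2) * 2 ^ l)"
      by simp
    then show "a = b" using ab by (simp add: bit_sum_of_bits)
  qed
  then show ?thesis
    using endo_inj_surj[of "{..<2 ^ k}" "bin_val k"] bin_val_less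
    by (auto simp: bij_betw_def)
qed

section \<open>The discrete Fourier transform\<close>

lemma cnj_exp: "cnj (exp z) = exp (cnj z)"
  by (simp add: complex_eq_iff Re_exp Im_exp)

text \<open>Orthogonality of the characters of the integers modulo \<open>N\<close>. For
  \<open>t \<noteq> s\<close> the terms are the powers of some \<open>z \<noteq> 1\<close> with
  \<open>z ^ N = 1\<close>, so their geometric sum vanishes.\<close>

lemma sum_exp_roots_of_unity:
  assumes "t < N" "s < N"
  shows "(\<Sum>e<N. exp (2 * \<i> * complex_of_real pi * of_nat e * (of_nat t - of_nat s) / of_nat N)) =
    (if t = s then of_nat N else 0)"
proof (cases "t = s")
  case False
  define z where "z = cis (2 * pi * ((real t - real s) / real N))"
  have N: "N > 0" using assms by simp
  have "exp (2 * \<i> * complex_of_real pi * of_nat e * (of_nat t - of_nat s) / of_nat N) = z ^ e" for e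
    unfolding z_def DeMoivre by (simp add: cis_conv_exp mult_ac)
  then have "(\<Sum>e<N. exp (2 * \<i> * complex_of_real pi * of_nat e * (of_nat t - of_nat s) / of_nat N)) =
      (\<Sum>e<N. z ^ e)" by simp
  \<comment> \<open>If \<open>z = 1\<close>, then \<open>t - s\<close> is an integer multiple of
    \<open>N\<close>; as its absolute value is below \<open>N\<close>, this forces
    \<open>t = s\<close>.\<close>
  moreover have "z \<noteq> 1"
  proof
    assume "z = 1"
    then have "cos (2 * pi * ((real t - real s) / real N)) = 1" by (metis cis.sel(1) z_def one_complex.sel(1))
    then obtain m :: int where "2 * pi * ((real t - real s) / real N) = of_int m * 2 * pi"
      using cos_one_2pi_int by metis
    then have "2 * pi * (real t - real s) = 2 * pi * (of_int m * real N)" using N by (simp add: field_simps)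
    then have "real t - real s = of_int m * real N" by simp
    then have "real_of_int (int t - int s) = real_of_int (m * int N)" by simp
    then have m: "int t - int s = m * int N" by (simp only: of_int_eq_iff)
    have "\<bar>int t - int s\<bar> < int N" using assms by linarith
    then have "\<bar>m\<bar> * int N < 1 * int N" unfolding m by (simp add: abs_mult)
    then have "m = 0" by (simp only: mult_less_cancel_right) auto
    then show False using m False by simp
  qed
  moreover have "z ^ N = 1"
  proof -
    have "z ^ N = cis (2 * pi * (real t - real s))" unfolding z_def DeMoivre using N by simp
    also have "\<dots> = 1" using cis_multiple_2pi[of "real t - real s"] by simp
    finally show ?thesis .
  qed
  ultimately show ?thesis using False geometric_sum[of z N] by simp
qed simp

lemma dim_IQFT [simp]: "dim_row (IQFT k n) = 2 ^ k" "dim_col (IQFT k n) = 2 ^ k"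
  by (simp_all add: IQFT_def)

lemma sum_exp_bin_val:
  assumes "t < 2 ^ k" "s < 2 ^ k"
  shows "(\<Sum>e<2 ^ k. exp (2 * \<i> * complex_of_real pi * of_nat (bin_val k e) * (of_nat t - of_nat s) / 2 ^ k)) =
    (if t = s then 2 ^ k else 0)"
  using sum_exp_roots_of_unity[OF assms]
    sum.reindex_bij_betw[OF bij_betw_bin_val[of k],
      of "\<lambda>e. exp (2 * \<i> * complex_of_real pi * of_nat e * (of_nat t - of_nat s) / 2 ^ k)"]
  by simp

lemma inverse_sqrt_power_two_squared:
  "1 / complex_of_real (sqrt (2 ^ k)) * (1 / complex_of_real (sqrt (2 ^ k))) = 1 / 2 ^ k"
proof -
  have "complex_of_real (sqrt (2 ^ k)) * complex_of_real (sqrt (2 ^ k)) = complex_of_real (2 ^ k)"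
    by (simp only: of_real_mult[symmetric] real_sqrt_mult_self) simp
  then show ?thesis by simp
qed

text \<open>The inner product of two columns is a character sum, because the modulus
  \<open>n + 1\<close> of the phases equals the dimension \<open>2 ^ k\<close>. Injectivity of
  \<open>bin_val\<close> converts equality of labels into equality of column indices.\<close>

lemma isometric_IQFT:
  assumes "n + 1 = 2 ^ k"
  shows "isometric_mat (IQFT k n)"
  unfolding isometric_mat_def
proof (rule eq_matI)
  fix i j assume "i < dim_row (1\<^sub>m (dim_col (IQFT k n)) :: complex mat)"
    "j < dim_col (1\<^sub>m (dim_col (IQFT k n)) :: complex mat)"
  then have ij: "i < 2 ^ k" "j < 2 ^ k" by simp_all
  let ?b = "\<lambda>x. of_nat (bin_val k x) :: complex"
  let ?s = "complex_of_real (sqrt (2 ^ k))"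
  have N: "of_nat (n + 1) = (2 ^ k :: complex)" "real (n + 1) = 2 ^ k"
    unfolding assms by simp_all
  have e: "cnj (IQFT k n $$ (x, i)) * IQFT k n $$ (x, j) =
      1 / 2 ^ k * exp (2 * \<i> * complex_of_real pi * ?b x * (?b i - ?b j) / 2 ^ k)" if "x < 2 ^ k" for x
  proof -
    have "IQFT k n $$ (x, j) = exp (- 2 * \<i> * complex_of_real pi * ?b j * ?b x / 2 ^ k) * (1 / ?s)"
      using that ij unfolding IQFT_def N by simp
    moreover have "cnj (IQFT k n $$ (x, i)) = exp (2 * \<i> * complex_of_real pi * ?b i * ?b x / 2 ^ k) * (1 / ?s)"
      using that ij unfolding IQFT_def N by (simp add: cnj_exp)
    ultimately have "cnj (IQFT k n $$ (x, i)) * IQFT k n $$ (x, j) = (1 / ?s * (1 / ?s)) *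
      (exp (2 * \<i> * complex_of_real pi * ?b i * ?b x / 2 ^ k) * exp (- 2 * \<i> * complex_of_real pi * ?b j * ?b x / 2 ^ k))"
      by (simp only: mult_ac)
    also have "\<dots> = 1 / 2 ^ k * exp (2 * \<i> * complex_of_real pi * ?b x * (?b i - ?b j) / 2 ^ k)"
      unfolding inverse_sqrt_power_two_squared mult_exp_exp
      by (intro arg_cong[of _ _ "\<lambda>z. 1 / 2 ^ k * exp z"]) (simp add: field_simps)
    finally show ?thesis .
  qed
  have "(mat_adjoint (IQFT k n) * IQFT k n) $$ (i, j) = (\<Sum>x<2 ^ k. cnj (IQFT k n $$ (x, i)) * IQFT k n $$ (x, j))"
    using ij by (simp add: scalar_prod_def atLeast0LessThan)
  also have "\<dots> = (\<Sum>x<2 ^ k. 1 / 2 ^ k * exp (2 * \<i> * complex_of_real pi * ?b x * (?b i - ?b j) / 2 ^ k))"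
    using e by (intro sum.cong) auto
  also have "\<dots> = 1 / 2 ^ k * (if bin_val k i = bin_val k j then 2 ^ k else 0)"
    unfolding sum_distrib_left[symmetric] by (simp only: sum_exp_bin_val bin_val_less)
  also have "\<dots> = (if i = j then 1 else 0)"
    using ij bij_betw_bin_val[of k] by (auto simp: bij_betw_def inj_on_def)
  finally show "(mat_adjoint (IQFT k n) * IQFT k n) $$ (i, j) = 1\<^sub>m (dim_col (IQFT k n)) $$ (i, j)"
    using ij by simp
qed simp_all

section \<open>The circuit\<close>

lemma isometric_hadamard: "isometric_mat hadamard"
proof -
  have h: "1 / complex_of_real (sqrt 2) * (1 / complex_of_real (sqrt 2)) = 1 / 2"
    using inverse_sqrt_power_two_squared[of 1] by simp
  show ?thesis
    unfolding isometric_mat_def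
    by (rule eq_matI) (use h in \<open>auto simp: hadamard_def scalar_prod_def numeral_2_eq_2 less_Suc_eq\<close>)
qed

text \<open>The Hadamard gates turn the all-zero control state into the uniform superposition: the
  only negative entry of \<open>hadamard\<close> lies outside column 0.\<close>

lemma hadamard_list_first_column:
  assumes "a < 2 ^ k"
  shows "kron_list (replicate k hadamard) $$ (a, 0) = 1 / complex_of_real (sqrt (2 ^ k))"
proof -
  have "kron_list (replicate k hadamard) $$ (a, 0) =
      (\<Prod>l<k. hadamard $$ (a div 2 ^ (k - 1 - l) mod 2, 0))"
    using assms by (subst index_kron_list) (auto simp: hadamard_def)
  also have "\<dots> = (\<Prod>l<k. 1 / complex_of_real (sqrt 2))"
    by (intro prod.cong) (auto simp: hadamard_def)
  also have "\<dots> = 1 / complex_of_real (sqrt (2 ^ k))"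
    by (simp add: real_sqrt_power power_one_over)
  finally show ?thesis .
qed

section \<open>Diagonal forms of the reflections and the controlled phases\<close>

lemma refl_S_eq_diag_of: "refl_S n t = diag_of (2 ^ n) (\<lambda>a. if hweight n a = t then - 1 else 1)"
  by (intro eq_matI) (auto simp: refl_S_def proj_P_def)

lemma hweight_le: "hweight n a \<le> n"
proof -
  have "hweight n a \<le> card {..<n}" unfolding hweight_def by (intro card_mono) auto
  then show ?thesis by simp
qed

lemma U_op_eq_diag_of:
  "U_op n s = diag_of (2 ^ n)
     (\<lambda>a. exp (2 * \<i> * complex_of_real pi * of_nat (hweight n a) * of_nat s / of_nat (n + 1)))"
proof -
  let ?c = "\<lambda>t. exp (2 * \<i> * complex_of_real pi * of_nat t * of_nat s / of_nat (n + 1))"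
  have "U_op n s = sum_mats (2 ^ n) (map (\<lambda>t. diag_of (2 ^ n) (\<lambda>a. if hweight n a = t then ?c t else 0)) [0..<n + 1])"
    unfolding U_op_def
    by (intro arg_cong[of _ _ "sum_mats (2 ^ n)"] map_cong refl eq_matI) (auto simp: proj_P_def)
  also have "\<dots> = diag_of (2 ^ n) (\<lambda>a. \<Sum>t\<leftarrow>[0..<n + 1]. if hweight n a = t then ?c t else 0)"
    by (rule sum_mats_diag_of)
  also have "\<dots> = diag_of (2 ^ n) (\<lambda>a. ?c (hweight n a))"
  proof (rule diag_of_cong)
    fix a
    have "(\<Sum>t\<leftarrow>[0..<n + 1]. if hweight n a = t then ?c t else 0) =
        (\<Sum>t\<in>{0..<n + 1}. if hweight n a = t then ?c t else 0)"
      by (simp only: interv_sum_list_conv_sum_set_nat set_upt)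
    \<comment> \<open>The weight is at most \<open>n\<close>, so it occurs in the range of summation
      and exactly one term survives.\<close>
    also have "\<dots> = ?c (hweight n a)"
      using hweight_le[of n a] by (subst sum.delta') auto
    finally show "(\<Sum>t\<leftarrow>[0..<n + 1]. if hweight n a = t then ?c t else 0) = ?c (hweight n a)" .
  qed
  finally show ?thesis .
qed

text \<open>Control qubit \<open>m\<close> is bit \<open>k - m\<close> of the control index. With
  that bit as a factor in the exponent, one exponential covers both branches: bit 0 gives the phase
  1, bit 1 the phase of \<open>U_op n (2 ^ (m - 1))\<close>.\<close>

lemma CU_eq_diag_of:
  assumes "1 \<le> m" "m \<le> k"
  shows "CU k n m = diag_of (2 ^ (k + n)) (\<lambda>i. exp (2 * \<i> * complex_of_real pi * of_nat (hweight n (i mod 2 ^ n)) *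
     of_nat ((i div 2 ^ n div 2 ^ (k - m) mod 2) * 2 ^ (m - 1)) / of_nat (n + 1)))"
proof -
  have k: "m - 1 + 1 + (k - m) = k" using assms by simp
  have 0: "ket0bra0 = diag_of 2 (\<lambda>i. if i = 0 then 1 else 0)"
    by (intro eq_matI) (auto simp: ket0bra0_def)
  have 1: "ket1bra1 = diag_of 2 (\<lambda>i. if i = 1 then 1 else 0)"
    by (intro eq_matI) (auto simp: ket1bra1_def)
  show ?thesis
    unfolding CU_def 0 1 kron_list_single_diag_of k one_mat_eq_diag_of[of "2 ^ n"] U_op_eq_diag_of
      diag_of_kron
    by (intro eq_matI) (auto simp: power_add)
qed

text \<open>Multiplying the phases adds their exponents, and the control bits weighted by powers of
  two add up to \<open>bin_val\<close>. Together the gates apply \<open>U_s\<close> to the system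
  when the control register holds \<open>s\<close>.\<close>

lemma prod_CU_eq_diag_of:
  "prod_mats (2 ^ (k + n)) (map (CU k n) [1..<k + 1]) = diag_of (2 ^ (k + n))
     (\<lambda>i. exp (2 * \<i> * complex_of_real pi * of_nat (hweight n (i mod 2 ^ n)) *
        of_nat (bin_val k (i div 2 ^ n)) / of_nat (n + 1)))"
proof -
  let ?e = "\<lambda>i x. 2 * \<i> * complex_of_real pi * of_nat (hweight n (i mod 2 ^ n)) * of_nat x / of_nat (n + 1)"
  let ?b = "\<lambda>i l. (i div 2 ^ n div 2 ^ (k - 1 - l) mod 2) * 2 ^ l"
  \<comment> \<open>Gate number \<open>m\<close> belongs to bit weight \<open>2 ^ l\<close> with
    \<open>l = m - 1\<close>, and then \<open>k - m\<close> becomes \<open>k - 1 - l\<close>, the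
    position used in \<open>bin_val\<close>.\<close>
  have "map (CU k n) [1..<k + 1] = map (\<lambda>l. CU k n (Suc l)) [0..<k]"
    by (simp add: map_Suc_upt[symmetric] comp_def del: upt_Suc)
  also have "\<dots> = map (\<lambda>l. diag_of (2 ^ (k + n)) (\<lambda>i. exp (?e i (?b i l)))) [0..<k]"
    by (auto simp: CU_eq_diag_of)
  finally have "prod_mats (2 ^ (k + n)) (map (CU k n) [1..<k + 1]) =
      diag_of (2 ^ (k + n)) (\<lambda>i. \<Prod>l\<leftarrow>[0..<k]. exp (?e i (?b i l)))"
    by (simp only: prod_mats_diag_of)
  also have "\<dots> = diag_of (2 ^ (k + n)) (\<lambda>i. exp (?e i (bin_val k (i div 2 ^ n))))"
  proof (rule diag_of_cong)
    fix i
    have "(\<Prod>l\<leftarrow>[0..<k]. exp (?e i (?b i l))) = (\<Prod>l<k. exp (?e i (?b i l)))"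
      by (simp only: prod.distinct_set_conv_list[OF distinct_upt, symmetric] set_upt atLeast0LessThan)
    also have "\<dots> = exp (\<Sum>l<k. ?e i (?b i l))" by (simp only: exp_sum finite_lessThan)
    also have "(\<Sum>l<k. ?e i (?b i l)) = ?e i (\<Sum>l<k. ?b i l)"
      by (simp only: sum_divide_distrib[symmetric] sum_distrib_left[symmetric] of_nat_sum)
    finally show "(\<Prod>l\<leftarrow>[0..<k]. exp (?e i (?b i l))) = exp (?e i (bin_val k (i div 2 ^ n)))"
      by (simp only: bin_val_def)
  qed
  finally show ?thesis .
qed

section \<open>The phase estimation circuit \<open>V\<close>\<close>

lemma hadamard_list_carrier: "kron_list (replicate k hadamard) \<in> carrier_mat (2 ^ k) (2 ^ k)"
  using carrier_kron_list[of "replicate k hadamard"] by (auto simp: hadamard_def)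

lemma dim_V_op: "dim_row (V_op k n) = 2 ^ k * 2 ^ n" "dim_col (V_op k n) = 2 ^ k * 2 ^ n"
  using hadamard_list_carrier[of k] by (auto simp: V_op_def)

lemma isometric_V_op:
  assumes "n + 1 = 2 ^ k"
  shows "isometric_mat (V_op k n)"
proof -
  have "isometric_mat (prod_mats (2 ^ (k + n)) (map (CU k n) [1..<k + 1]))"
    unfolding prod_CU_eq_diag_of by (intro isometric_diag_of) (simp add: norm_exp_eq_Re)
  moreover have "isometric_mat (kron_list (replicate k hadamard))"
    by (intro isometric_mat_kron_list) (auto simp: isometric_hadamard)
  moreover have "dim_row (kron_list (replicate k hadamard)) = 2 ^ k"
    using hadamard_list_carrier by auto
  ultimately show ?thesis
    unfolding V_op_def prod_CU_eq_diag_of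
    by (intro isometric_mat_mult isometric_mat_kron isometric_IQFT isometric_mat_one assms)
       (simp_all add: power_add)
qed

text \<open>The state \<open>\<Sum>\<^sub>b v\<^sub>b |bin(|b|)\<rangle>|b\<rangle>\<close>.\<close>

definition weight_tagged :: "nat \<Rightarrow> nat \<Rightarrow> complex vec \<Rightarrow> complex vec" where
  "weight_tagged k n v = vec (2 ^ k * 2 ^ n)
     (\<lambda>i. if bin_val k (i div 2 ^ n) = hweight n (i mod 2 ^ n) then v $ (i mod 2 ^ n) else 0)"

text \<open>For output control index \<open>a\<close> and system index \<open>b\<close>, the
  amplitude is a sum over the intermediate control index \<open>e\<close>. The controlled phases
  contribute the character at \<open>hweight n b\<close>, the inverse Fourier transform the
  conjugate character at \<open>bin_val k a\<close>; orthogonality keeps only equal labels.\<close>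

lemma V_op_mult_vkron:
  assumes "n + 1 = 2 ^ k" "dim_vec v = 2 ^ n"
  shows "V_op k n *\<^sub>v vkron (unit_vec (2 ^ k) 0) v = weight_tagged k n v"
proof (rule eq_vecI)
  let ?H = "kron_list (replicate k hadamard)"
  let ?F = "\<lambda>i. exp (2 * \<i> * complex_of_real pi * of_nat (hweight n (i mod 2 ^ n)) *
        of_nat (bin_val k (i div 2 ^ n)) / of_nat (n + 1))"
  let ?D = "diag_of (2 ^ k * 2 ^ n) ?F"
  let ?s = "complex_of_real (sqrt (2 ^ k))"
  have H: "dim_row ?H = 2 ^ k" "dim_col ?H = 2 ^ k" using hadamard_list_carrier[of k] by auto
  have N: "of_nat (n + 1) = (2 ^ k :: complex)" "real (n + 1) = 2 ^ k"
    unfolding assms by simp_all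
  have V: "V_op k n = kron (IQFT k n) (1\<^sub>m (2 ^ n)) * ?D * kron ?H (1\<^sub>m (2 ^ n))"
    unfolding V_op_def prod_CU_eq_diag_of unfolding power_add ..
  fix i assume "i < dim_vec (weight_tagged k n v)"
  then have i: "i < 2 ^ k * 2 ^ n" by (simp add: weight_tagged_def)
  then have ia: "i div 2 ^ n < 2 ^ k" by (simp add: div_mod_less_mult)
  define a b where "a = i div 2 ^ n" and "b = i mod 2 ^ n"
  \<comment> \<open>The weight is at most \<open>n\<close>, hence below \<open>2 ^ k\<close>: every
    weight is a label of the control register, as orthogonality of the characters requires.\<close>
  have b: "b < 2 ^ n" "hweight n b < 2 ^ k"
    using hweight_le[of n b] assms(1) by (simp_all add: b_def)
  have Q: "kron (IQFT k n) (1\<^sub>m (2 ^ n)) \<in> carrier_mat (2 ^ k * 2 ^ n) (2 ^ k * 2 ^ n)"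
    and D: "?D \<in> carrier_mat (2 ^ k * 2 ^ n) (2 ^ k * 2 ^ n)"
    and KH: "kron ?H (1\<^sub>m (2 ^ n)) \<in> carrier_mat (2 ^ k * 2 ^ n) (2 ^ k * 2 ^ n)"
    using H by auto
  have u0: "vkron (unit_vec (2 ^ k) 0) v \<in> carrier_vec (2 ^ k * 2 ^ n)"
    using assms(2) by (intro carrier_vecI) simp
  let ?u = "vkron (?H *\<^sub>v unit_vec (2 ^ k) 0) v"
  have "V_op k n *\<^sub>v vkron (unit_vec (2 ^ k) 0) v =
      kron (IQFT k n) (1\<^sub>m (2 ^ n)) *\<^sub>v (?D *\<^sub>v (kron ?H (1\<^sub>m (2 ^ n)) *\<^sub>v vkron (unit_vec (2 ^ k) 0) v))"
    unfolding V
    by (simp only: assoc_mult_mat_vec[OF mult_carrier_mat[OF Q D] KH u0]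
        assoc_mult_mat_vec[OF Q D mult_mat_vec_carrier[OF KH u0]])
  also have "kron ?H (1\<^sub>m (2 ^ n)) *\<^sub>v vkron (unit_vec (2 ^ k) 0) v = ?u"
  proof -
    have "kron ?H (1\<^sub>m (2 ^ n)) *\<^sub>v vkron (unit_vec (2 ^ k) 0) v =
        vkron (?H *\<^sub>v unit_vec (2 ^ k) 0) (1\<^sub>m (2 ^ n) *\<^sub>v v)"
      by (rule kron_mult_vkron) (simp_all only: H assms(2) index_unit_vec index_one_mat)
    also have "1\<^sub>m (2 ^ n) *\<^sub>v v = v" by (rule one_mult_mat_vec[OF carrier_vecI[OF assms(2)]])
    finally show ?thesis .
  qed
  finally have Vu: "V_op k n *\<^sub>v vkron (unit_vec (2 ^ k) 0) v =
      kron (IQFT k n) (1\<^sub>m (2 ^ n)) *\<^sub>v (?D *\<^sub>v ?u)" .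
  \<comment> \<open>The Fourier transform acts on the control register alone, so \<open>b\<close>
    stays fixed and only \<open>e\<close> is summed.\<close>
  have "(V_op k n *\<^sub>v vkron (unit_vec (2 ^ k) 0) v) $ i =
      (\<Sum>e<2 ^ k. IQFT k n $$ (a, e) * (?D *\<^sub>v ?u) $ (e * 2 ^ n + b))"
    unfolding Vu a_def b_def using i by (subst kron_one_mult_vec_index) simp_all
  also have "\<dots> = (\<Sum>e<2 ^ k. v $ b / 2 ^ k * exp (2 * \<i> * complex_of_real pi * of_nat (bin_val k e) *
      (of_nat (hweight n b) - of_nat (bin_val k a)) / 2 ^ k))"
  proof (rule sum.cong)
    fix e :: nat assume "e \<in> {..<2 ^ k}"
    then have e: "e < 2 ^ k" by simp
    have "e * 2 ^ n + b < (e + 1) * 2 ^ n" using b by simp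
    also have "\<dots> \<le> 2 ^ k * 2 ^ n" using e by (intro mult_right_mono) auto
    finally have less: "e * 2 ^ n + b < 2 ^ k * 2 ^ n" .
    have dm: "(e * 2 ^ n + b) div 2 ^ n = e" "(e * 2 ^ n + b) mod 2 ^ n = b" using b by simp_all
    have u: "?u $ (e * 2 ^ n + b) = 1 / ?s * v $ b"
      using less H e assms(2) dm by (simp add: hadamard_list_first_column)
    have "(?D *\<^sub>v ?u) $ (e * 2 ^ n + b) = ?F (e * 2 ^ n + b) * ?u $ (e * 2 ^ n + b)"
      using less H assms(2) by (intro diag_of_mult_vec_index) simp_all
    then have "(?D *\<^sub>v ?u) $ (e * 2 ^ n + b) = exp (2 * \<i> * complex_of_real pi * of_nat (hweight n b) *
        of_nat (bin_val k e) / 2 ^ k) * (1 / ?s * v $ b)"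
      unfolding u dm N .
    moreover have "IQFT k n $$ (a, e) = exp (- 2 * \<i> * complex_of_real pi * of_nat (bin_val k e) *
        of_nat (bin_val k a) / 2 ^ k) * (1 / ?s)"
      using e ia unfolding IQFT_def N a_def by simp
    ultimately have "IQFT k n $$ (a, e) * (?D *\<^sub>v ?u) $ (e * 2 ^ n + b) = (1 / ?s * (1 / ?s)) * v $ b *
        (exp (- 2 * \<i> * complex_of_real pi * of_nat (bin_val k e) * of_nat (bin_val k a) / 2 ^ k) *
         exp (2 * \<i> * complex_of_real pi * of_nat (hweight n b) * of_nat (bin_val k e) / 2 ^ k))"
      by (simp only: mult_ac)
    \<comment> \<open>The normalisations of the Hadamard gates and of the Fourier transform multiply
      to \<open>1 / 2 ^ k\<close>; the exponents combine into the difference of the labels.\<close>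
    also have "\<dots> = v $ b / 2 ^ k * exp (2 * \<i> * complex_of_real pi * of_nat (bin_val k e) *
      (of_nat (hweight n b) - of_nat (bin_val k a)) / 2 ^ k)"
      unfolding inverse_sqrt_power_two_squared mult_exp_exp
      by (intro arg_cong2[of _ _ _ _ "\<lambda>y z. y * exp z"]) (simp_all add: field_simps)
    finally show "IQFT k n $$ (a, e) * (?D *\<^sub>v ?u) $ (e * 2 ^ n + b) =
      v $ b / 2 ^ k * exp (2 * \<i> * complex_of_real pi * of_nat (bin_val k e) *
      (of_nat (hweight n b) - of_nat (bin_val k a)) / 2 ^ k)" .
  qed simp
  also have "\<dots> = v $ b / 2 ^ k * (if hweight n b = bin_val k a then 2 ^ k else 0)"
    unfolding sum_distrib_left[symmetric] using b by (simp only: sum_exp_bin_val bin_val_less)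
  also have "\<dots> = weight_tagged k n v $ i"
    using i by (simp add: weight_tagged_def a_def b_def)
  finally show "(V_op k n *\<^sub>v vkron (unit_vec (2 ^ k) 0) v) $ i = weight_tagged k n v $ i" .
qed (simp add: weight_tagged_def dim_V_op)

section \<open>The marking operator and its transfer to the system register\<close>

text \<open>The flips \<open>Xr\<close> form a symmetric involution exchanging the all-ones state
  \<open>L\<close> with the state that encodes \<open>r\<close>. As \<open>CZ k\<close> is the
  reflection that negates \<open>L\<close>, conjugating it by \<open>Xr\<close> gives the reflection
  that negates the state encoding \<open>r\<close>.\<close>

lemma O_op_eq_diag_of:
  assumes "r < 2 ^ k"
  shows "O_op k r = diag_of (2 ^ k) (\<lambda>a. if bin_val k a = r then - 1 else 1)"
proof -
  define Ms where "Ms = map (\<lambda>l. if r div 2 ^ l mod 2 = 1 then 1\<^sub>m 2 else sigma_x) [0..<k]"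
  define Xr where "Xr = kron_list Ms"
  define L :: nat where "L = 2 ^ k - 1"
  have L: "L < 2 ^ k" by (simp add: L_def)
  have len: "length Ms = k" by (simp add: Ms_def)
  have Ms: "M \<in> carrier_mat 2 2" if "M \<in> set Ms" for M
    using that by (auto simp: Ms_def sigma_x_def)
  have X: "dim_row Xr = 2 ^ k" "dim_col Xr = 2 ^ k"
    using carrier_kron_list[OF Ms] len by (auto simp: Xr_def)
  \<comment> \<open>One formula for both kinds of factor: ones on the diagonal (identity) where
    \<open>r\<close> has bit 1, ones off the diagonal (\<open>sigma_x\<close>) where it has bit
    0.\<close>
  have Ms_nth: "(Ms ! l) $$ (x, y) = (if (x = y) = (r div 2 ^ l mod 2 = 1) then 1 else 0)"
    if "l < k" "x < 2" "y < 2" for l x y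
    using that by (auto simp: Ms_def sigma_x_def)
  have entry: "Xr $$ (a, b) = (\<Prod>l<k. if (a div 2 ^ (k - 1 - l) mod 2 = b div 2 ^ (k - 1 - l) mod 2) =
      (r div 2 ^ l mod 2 = 1) then 1 else 0)" if "a < 2 ^ k" "b < 2 ^ k" for a b
    unfolding Xr_def using that Ms by (subst index_kron_list) (auto simp: len Ms_nth intro!: prod.cong)
  have sym: "Xr $$ (a, b) = Xr $$ (b, a)" if "a < 2 ^ k" "b < 2 ^ k" for a b
    using that by (auto simp: entry intro!: prod.cong)
  \<comment> \<open>\<open>Xr\<close> is real and symmetric, hence its own adjoint; being isometric
    then makes it an involution.\<close>
  have "cnj (Xr $$ (a, b)) = Xr $$ (b, a)" if "a < 2 ^ k" "b < 2 ^ k" for a b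
    unfolding sym[OF that(2,1)] using that by (auto simp: entry intro!: prod.cong)
  then have adj: "mat_adjoint Xr = Xr" using X by (intro eq_matI) auto
  have "isometric_mat sigma_x"
    unfolding isometric_mat_def
    by (rule eq_matI) (auto simp: sigma_x_def scalar_prod_def numeral_2_eq_2 less_Suc_eq)
  then have "isometric_mat Xr"
    unfolding Xr_def by (intro isometric_mat_kron_list) (auto simp: Ms_def isometric_mat_one split: if_splits)
  then have XX: "Xr * Xr = 1\<^sub>m (2 ^ k)" using adj X by (simp add: isometric_mat_def)
  have last: "Xr $$ (a, L) = (if bin_val k a = r then 1 else 0)" if "a < 2 ^ k" for a
  proof -
    \<comment> \<open>\<open>L = 2 ^ k - 1\<close> is the sum of all \<open>2 ^ l\<close> with
      \<open>l < k\<close>, so each of its bits is 1.\<close>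
    have bit: "L div 2 ^ (k - 1 - l) mod 2 = 1" if "l < k" for l
      using bit_of_bit_sum[of k "\<lambda>_. 1" "k - 1 - l"] that sum_power2[of k]
      by (simp add: L_def atLeast0LessThan)
    have "Xr $$ (a, L) = (\<Prod>l<k. if a div 2 ^ (k - 1 - l) mod 2 = r div 2 ^ l mod 2 then 1 else 0)"
      unfolding entry[OF that L] by (intro prod.cong) (use bit in auto)
    also have "\<dots> = (if \<forall>l<k. a div 2 ^ (k - 1 - l) mod 2 = r div 2 ^ l mod 2 then 1 else 0)"
      by (auto intro!: prod.neutral)
    finally show ?thesis using bin_val_eq_iff[OF assms] by simp
  qed
  let ?f = "\<lambda>x. if x = L then - 1 else 1 :: complex"
  have CZ: "CZ k = diag_of (2 ^ k) ?f" by (auto simp: CZ_def L_def intro!: eq_matI)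
  have "O_op k r = Xr * diag_of (2 ^ k) ?f * Xr"
    by (simp add: O_op_def CZ Xr_def Ms_def Let_def)
  also have "\<dots> = Xr * (diag_of (2 ^ k) ?f * Xr)"
    by (rule assoc_mult_mat) (use X in auto)
  also have "\<dots> = diag_of (2 ^ k) (\<lambda>a. if bin_val k a = r then - 1 else 1)"
  proof (rule eq_matI)
    fix a b assume "a < dim_row (diag_of (2 ^ k) (\<lambda>a. if bin_val k a = r then - 1 else 1))"
      "b < dim_col (diag_of (2 ^ k) (\<lambda>a. if bin_val k a = r then - 1 else 1))"
    then have ab: "a < 2 ^ k" "b < 2 ^ k" by simp_all
    have "(Xr * (diag_of (2 ^ k) ?f * Xr)) $$ (a, b) = (\<Sum>x<2 ^ k. Xr $$ (a, x) * (?f x * Xr $$ (x, b)))"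
    proof -
      have "(diag_of (2 ^ k) ?f * Xr) $$ (x, b) = ?f x * Xr $$ (x, b)" if "x < 2 ^ k" for x
        using diag_of_mult_vec_index[of x "2 ^ k" "col Xr b" ?f] that ab X by simp
      then show ?thesis using ab X
        by (subst index_mult_mat) (auto simp: scalar_prod_def atLeast0LessThan simp del: index_mult_mat(1) intro!: sum.cong)
    qed
    \<comment> \<open>The sign \<open>?f\<close> is 1 minus twice the indicator of \<open>L\<close>,
      so the entry is that of \<open>Xr * Xr\<close> minus a rank-one correction built from column
      \<open>L\<close>.\<close>
    also have "\<dots> = (\<Sum>x<2 ^ k. Xr $$ (a, x) * Xr $$ (x, b) - (if x = L then 2 * Xr $$ (a, x) * Xr $$ (x, b) else 0))"
      by (intro sum.cong) auto
    also have "\<dots> = (\<Sum>x<2 ^ k. Xr $$ (a, x) * Xr $$ (x, b)) - 2 * Xr $$ (a, L) * Xr $$ (L, b)"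
      using L by (simp add: sum_subtractf)
    also have "(\<Sum>x<2 ^ k. Xr $$ (a, x) * Xr $$ (x, b)) = (Xr * Xr) $$ (a, b)"
      using ab X by (simp add: scalar_prod_def atLeast0LessThan)
    \<comment> \<open>The correction is nonzero only if \<open>a\<close> and \<open>b\<close> both
      encode \<open>r\<close>, and then \<open>a = b\<close> by injectivity of
      \<open>bin_val\<close>.\<close>
    also have "\<dots> - 2 * Xr $$ (a, L) * Xr $$ (L, b) =
        diag_of (2 ^ k) (\<lambda>a. if bin_val k a = r then - 1 else 1) $$ (a, b)"
      using ab L bij_betw_bin_val[of k]
      by (auto simp: XX last sym[OF L ab(2)] bij_betw_def inj_on_def)
    finally show "(Xr * (diag_of (2 ^ k) ?f * Xr)) $$ (a, b) =
        diag_of (2 ^ k) (\<lambda>a. if bin_val k a = r then - 1 else 1) $$ (a, b)" .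
  qed (use X in auto)
  finally show ?thesis .
qed

text \<open>On the support of a tagged state the control label equals the weight, so testing the
  label against \<open>r\<close> gives the same sign as testing the weight.\<close>

lemma O_op_mult_weight_tagged:
  assumes "r < 2 ^ k" "dim_vec v = 2 ^ n"
  shows "kron (O_op k r) (1\<^sub>m (2 ^ n)) *\<^sub>v weight_tagged k n v = weight_tagged k n (refl_S n r *\<^sub>v v)"
  unfolding O_op_eq_diag_of[OF assms(1)] one_mat_eq_diag_of diag_of_kron refl_S_eq_diag_of
  using assms(2)
  by (intro eq_vecI) (auto simp: weight_tagged_def diag_of_mult_vec_index simp del: index_mult_mat_vec)

text \<open>Apply the adjoint to \<open>V_op_mult_vkron\<close> and cancel by isometry. The vector
  is arbitrary because the untagging happens after the reflection has changed the system
  state.\<close>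

lemma adjoint_V_op_mult_weight_tagged:
  assumes "n + 1 = 2 ^ k" "dim_vec v = 2 ^ n"
  shows "mat_adjoint (V_op k n) *\<^sub>v weight_tagged k n v = vkron (unit_vec (2 ^ k) 0) v"
proof -
  have "mat_adjoint (V_op k n) *\<^sub>v (V_op k n *\<^sub>v vkron (unit_vec (2 ^ k) 0) v) =
      (mat_adjoint (V_op k n) * V_op k n) *\<^sub>v vkron (unit_vec (2 ^ k) 0) v"
    by (rule assoc_mult_mat_vec[symmetric]) (use assms in \<open>auto simp: dim_V_op intro!: carrier_vecI\<close>)
  also have "\<dots> = vkron (unit_vec (2 ^ k) 0) v"
    using isometric_V_op[OF assms(1)] assms(2) by (auto simp: isometric_mat_def dim_V_op intro!: one_mult_mat_vec carrier_vecI)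
  finally show ?thesis using V_op_mult_vkron[OF assms] by simp
qed

section \<open>Composition of the full iteration\<close>

lemma C_X_carrier: "C_X n X \<in> carrier_mat (2 ^ n) (2 ^ n)"
proof -
  have "sum_mats d Ms \<in> carrier_mat d d" for d Ms
    by (induction Ms) (auto simp: sum_mats_def)
  then have "majorana n x \<in> carrier_mat (2 ^ n) (2 ^ n)" for x by (simp add: majorana_def)
  moreover have "(\<And>M. M \<in> set Ms \<Longrightarrow> M \<in> carrier_mat d d) \<Longrightarrow> prod_mats d Ms \<in> carrier_mat d d" for d Ms
    by (induction Ms) (auto simp: prod_mats_def intro!: mult_carrier_mat)
  ultimately show ?thesis unfolding C_X_def by (metis (no_types, lifting) ex_map_conv)
qed

theorem mainTheorem4:
  fixes k n r :: nat and X :: "real mat"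
  assumes "k \<ge> 1" and "n = 2 ^ k - 1"
    and "1 \<le> r" and "r < n"
    and "X \<in> carrier_mat n r"
    and "\<forall>l<r. (\<Sum>i<n. (X $$ (i, l))\<^sup>2) = 1"
    and "\<forall>v \<in> carrier_vec r. X *\<^sub>v v = 0\<^sub>v n \<longrightarrow> v = 0\<^sub>v r"
  shows "(let CXm = C_X n X;
              Ik = 1\<^sub>m (2 ^ k);
              C = - (kron Ik CXm * kron Ik (refl_S n 0) * kron Ik (mat_adjoint CXm)
                     * mat_adjoint (V_op k n) * kron (O_op k r) (1\<^sub>m (2 ^ n)) * V_op k n);
              Q = - (CXm * refl_S n 0 * mat_adjoint CXm * refl_S n r);
              psi = columns_state n X
          in C *\<^sub>v vkron (unit_vec (2 ^ k) 0) psi = vkron (unit_vec (2 ^ k) 0) (Q *\<^sub>v psi))"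
proof -
  \<comment> \<open>As \<open>2 ^ k\<close> is positive, the subtraction in \<open>2 ^ k - 1\<close>
    is not truncated; \<open>r < n\<close> makes \<open>r\<close> a label of the control
    register.\<close>
  have n: "n + 1 = 2 ^ k" and r: "r < 2 ^ k" using assms(2,4) by simp_all
  define A psi e where "A = C_X n X" and "psi = columns_state n X" and "e = (unit_vec (2 ^ k) 0 :: complex vec)"
  \<comment> \<open>The system state once the tag has been computed, tested and removed.\<close>
  define phi where "phi = refl_S n r *\<^sub>v psi"
  let ?I = "1\<^sub>m (2 ^ k) :: complex mat"
  let ?N = "2 ^ k * 2 ^ n :: nat"
  have A: "A \<in> carrier_mat (2 ^ n) (2 ^ n)" using C_X_carrier by (simp add: A_def)
  then have A': "mat_adjoint A \<in> carrier_mat (2 ^ n) (2 ^ n)" by auto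
  have S: "refl_S n t \<in> carrier_mat (2 ^ n) (2 ^ n)" for t by (auto simp: refl_S_eq_diag_of)
  have psi: "psi \<in> carrier_vec (2 ^ n)"
    using C_X_carrier[of n X] by (auto simp: psi_def columns_state_def)
  have phi: "phi \<in> carrier_vec (2 ^ n)" unfolding phi_def by (rule mult_mat_vec_carrier[OF S psi])
  have e: "dim_vec e = 2 ^ k" by (simp add: e_def)
  have K: "kron ?I M \<in> carrier_mat ?N ?N" if "M \<in> carrier_mat (2 ^ n) (2 ^ n)" for M
    using that by auto
  have KV: "kron ?I M *\<^sub>v vkron e v = vkron e (M *\<^sub>v v)"
    if "M \<in> carrier_mat (2 ^ n) (2 ^ n)" "v \<in> carrier_vec (2 ^ n)" for M v
    using that by (subst kron_mult_vkron) (auto simp: e_def)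
  have V: "V_op k n \<in> carrier_mat ?N ?N" "mat_adjoint (V_op k n) \<in> carrier_mat ?N ?N"
    by (auto simp: dim_V_op)
  have O: "kron (O_op k r) (1\<^sub>m (2 ^ n)) \<in> carrier_mat ?N ?N"
    by (auto simp: O_op_eq_diag_of[OF r])
  have vk: "vkron e v \<in> carrier_vec ?N" if "v \<in> carrier_vec (2 ^ n)" for v
    using that e by (auto intro!: carrier_vecI)
  \<comment> \<open>The factors that act on the system alone; the rest of the product is the phase
    estimation sandwich around the marking operator.\<close>
  let ?P = "kron ?I A * kron ?I (refl_S n 0) * kron ?I (mat_adjoint A)"
  have P: "?P \<in> carrier_mat ?N ?N" 
    by (rule mult_carrier_mat[OF mult_carrier_mat[OF K[OF A] K[OF S]] K[OF A']])
  let ?T = "?P * mat_adjoint (V_op k n) * kron (O_op k r) (1\<^sub>m (2 ^ n)) * V_op k n"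
  let ?R = "A * refl_S n 0 * mat_adjoint A * refl_S n r"
  have PVO: "?P * mat_adjoint (V_op k n) * kron (O_op k r) (1\<^sub>m (2 ^ n)) \<in> carrier_mat ?N ?N"
    by (rule mult_carrier_mat[OF mult_carrier_mat[OF P V(2)] O])
  have T: "?T \<in> carrier_mat ?N ?N" by (rule mult_carrier_mat[OF PVO V(1)])
  have ASA: "A * refl_S n 0 * mat_adjoint A \<in> carrier_mat (2 ^ n) (2 ^ n)"
    by (rule mult_carrier_mat[OF mult_carrier_mat[OF A S] A'])
  \<comment> \<open>The factors are peeled off from the right: tag, test, untag, then the system
    operators.\<close>
  have "?T *\<^sub>v vkron e psi = (?P * mat_adjoint (V_op k n) * kron (O_op k r) (1\<^sub>m (2 ^ n))) *\<^sub>v (V_op k n *\<^sub>v vkron e psi)"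
    by (rule assoc_mult_mat_vec[OF PVO V(1) vk[OF psi]])
  also have "V_op k n *\<^sub>v vkron e psi = weight_tagged k n psi"
    unfolding e_def using psi by (intro V_op_mult_vkron n) auto
  also have "(?P * mat_adjoint (V_op k n) * kron (O_op k r) (1\<^sub>m (2 ^ n))) *\<^sub>v weight_tagged k n psi =
      (?P * mat_adjoint (V_op k n)) *\<^sub>v (kron (O_op k r) (1\<^sub>m (2 ^ n)) *\<^sub>v weight_tagged k n psi)"
    by (rule assoc_mult_mat_vec[OF mult_carrier_mat[OF P V(2)] O]) (auto simp: weight_tagged_def)
  also have "kron (O_op k r) (1\<^sub>m (2 ^ n)) *\<^sub>v weight_tagged k n psi = weight_tagged k n phi"
    unfolding phi_def using psi by (intro O_op_mult_weight_tagged r) auto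
  also have "(?P * mat_adjoint (V_op k n)) *\<^sub>v weight_tagged k n phi =
      ?P *\<^sub>v (mat_adjoint (V_op k n) *\<^sub>v weight_tagged k n phi)"
    by (rule assoc_mult_mat_vec[OF P V(2)]) (auto simp: weight_tagged_def)
  also have "mat_adjoint (V_op k n) *\<^sub>v weight_tagged k n phi = vkron e phi"
    unfolding e_def using phi by (intro adjoint_V_op_mult_weight_tagged n) auto
  also have "?P *\<^sub>v vkron e phi = vkron e (?R *\<^sub>v psi)"
  proof -
    have "?P = kron ?I (A * refl_S n 0 * mat_adjoint A)"
      using A S[of 0] by (auto simp: kron_mult)
    then show ?thesis by (simp only: KV[OF ASA phi] phi_def[symmetric] assoc_mult_mat_vec[OF ASA S psi])
  qed
  finally have eq: "?T *\<^sub>v vkron e psi = vkron e (?R *\<^sub>v psi)" .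
  \<comment> \<open>The overall sign of \<open>C\<close> is moved into the system factor, where it
    becomes the sign of \<open>Q\<close>.\<close>
  have "(- ?T) *\<^sub>v vkron e psi = - (?T *\<^sub>v vkron e psi)"
    by (rule uminus_mult_mat_vec) (simp only: carrier_vecD[OF vk[OF psi]] carrier_matD[OF T])
  also have "\<dots> = vkron e (- (?R *\<^sub>v psi))"
    unfolding eq by (intro eq_vecI) (auto simp: div_mod_less_mult)
  also have "- (?R *\<^sub>v psi) = (- ?R) *\<^sub>v psi"
    by (rule uminus_mult_mat_vec[symmetric]) (use S[of r] psi in auto)
  finally show ?thesis by (simp only: Let_def A_def psi_def e_def)
qed

end
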